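(* Let $(G,H,\mathcal G)$ be a pseudo-Riemannian generalized Lie group. Then the space of left-invariant Levi-Civita generalized connections on $G$ is an affine space modeled on $\Sigma_+\oplus\Sigma_-$ (the generalized first prolongation), where $\Sigma_+\subset E_+^*\otimes\mathfrak{so}(E_+)$ is the kernel of the map $$\partial:E_+^*\otimes\mathfrak{so}(E_+)\to\textstyle\bigwedge^3E^*,\qquad(\partial\alpha)(u,v,w)=\langle\alpha_uv,w\rangle+\langle\alpha_vw,u\rangle+\langle\alpha_wu,v\rangle,$$ and $\Sigma_-\subset E_-^*\otimes\mathfrak{so}(E_-)$ is defined similarly. Moreover, $$\Sigma_+=\mathrm{im}(\mathrm{alt})\cong\frac{\mathrm{Sym}^2E_+\otimes E_+}{\mathrm{Sym}^3E_+}$$ is the image of the map $\mathrm{alt}:\mathrm{Sym}^2E_+^*\otimes E_+^*\to E_+^*\otimes\mathfrak{so}(E_+)$ defined by $\langle\mathrm{alt}(\sigma)_uv,w\rangle=\sigma(u,v,w)-\sigma(u,w,v)$, and similarly for $\Sigma_-$.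
   Context: Let $G$ be a Lie group with Lie algebra $\mathfrak g$ and $E=\mathfrak g\oplus\mathfrak g^*$, with scalar product $\langle X+\xi,Y+\eta\rangle=\frac12(\xi(Y)+\eta(X))$; for a closed three-form $H\in\bigwedge^3\mathfrak g^*$ the Dorfman bracket is $[X+\xi,Y+\eta]_H=[X,Y]-\mathrm{ad}_X^*\eta+\mathrm{ad}_Y^*\xi+H(X,Y,\cdot)$, where $\mathrm{ad}_X^*\eta=\eta\circ\mathrm{ad}_X$. A pseudo-Riemannian generalized Lie group $(G,H,\mathcal G)$ consists of $G$, a closed left-invariant three-form $H$ and $\mathcal G\in\mathrm{Sym}^2E^*$ such that the endomorphism $\mathcal G^{\mathrm{end}}$ defined by $\langle\mathcal G^{\mathrm{end}}\cdot,\cdot\rangle=\mathcal G$ is an involution and $\mathcal G|_{\mathfrak g^*}$ is non-degenerate. $E_\pm$ are the $\pm1$-eigenspaces of $\mathcal G^{\mathrm{end}}$; $E=E_+\oplus E_-$ is $\langle\cdot,\cdot\rangle$-orthogonal. A left-invariant generalized connection is identified with an element $D\in E^*\otimes\mathfrak{so}(E)$, $u\mapsto D_u$. Its torsion is $T(u,v)=D_uv-D_vu-[u,v]_H+(Du)^*v$, where $Du\in\mathrm{End}(E)$ is $w\mapsto D_wu$ and $*$ is the adjoint for $\langle\cdot,\cdot\rangle$. $D$ is a Levi-Civita generalized connection if $T=0$ and $D$ is metric, i.e. $D_uE_\pm\subset E_\pm$ for all $u$. Elements $\alpha\in E_\pm^*\otimes\mathfrak{so}(E_\pm)$ are regarded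 as elements of $E^*\otimes\mathfrak{so}(E)$, extended by zero on $E_\mp$; $\alpha_u\in\mathfrak{so}(E_\pm)$ denotes evaluation at $u$. *)

theory Defs
  imports "HOL-Analysis.Analysis" "HOL-Library.Function_Algebras"
begin

section \<open>Linear algebra\<close>

text \<open>
  Functions into a real vector space form a real vector space pointwise. Multilinear maps are
  curried functions, and spaces of them are subspaces of these function spaces.
\<close>

instantiation "fun" :: (type, real_vector) real_vector
begin

definition scaleR_fun :: "real \<Rightarrow> ('a \<Rightarrow> 'b) \<Rightarrow> 'a \<Rightarrow> 'b" where
  "scaleR_fun c f = (\<lambda>x. c *\<^sub>R f x)"

instance
  by standard (auto simp: scaleR_fun_def plus_fun_def scaleR_add_right scaleR_add_left)

end

text \<open>The full algebraic dual; no topology is involved.\<close>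

typedef (overloaded) 'a dual_space = "{f :: 'a::real_vector \<Rightarrow> real. linear f}"
  morphisms dual_apply Dual
  by (rule exI[of _ "\<lambda>_. 0"]) (simp add: linear_iff)

setup_lifting type_definition_dual_space

instantiation dual_space :: (real_vector) real_vector
begin

lift_definition zero_dual_space :: "'a dual_space" is "\<lambda>_. 0"
  by (simp add: linear_iff)

lift_definition plus_dual_space :: "'a dual_space \<Rightarrow> 'a dual_space \<Rightarrow> 'a dual_space"
  is "\<lambda>f g x. f x + g x"
  by (simp add: linear_iff algebra_simps)

lift_definition minus_dual_space :: "'a dual_space \<Rightarrow> 'a dual_space \<Rightarrow> 'a dual_space"
  is "\<lambda>f g x. f x - g x"
  by (simp add: linear_iff algebra_simps)

lift_definition uminus_dual_space :: "'a dual_space \<Rightarrow> 'a dual_space"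
  is "\<lambda>f x. - f x"
  by (simp add: linear_iff)

lift_definition scaleR_dual_space :: "real \<Rightarrow> 'a dual_space \<Rightarrow> 'a dual_space"
  is "\<lambda>c f x. c * f x"
  by (simp add: linear_iff algebra_simps)

instance
  by standard (transfer; simp add: algebra_simps fun_eq_iff)+

end

definition trilinear :: "('a::real_vector \<Rightarrow> 'a \<Rightarrow> 'a \<Rightarrow> 'b::real_vector) \<Rightarrow> bool" where
  "trilinear t \<longleftrightarrow>
    (\<forall>x y. linear (\<lambda>z. t z x y) \<and> linear (\<lambda>z. t x z y) \<and> linear (\<lambda>z. t x y z))"

definition three_forms :: "('a::real_vector \<Rightarrow> 'a \<Rightarrow> 'a \<Rightarrow> real) set" where
  "three_forms = {t. trilinear t \<and> (\<forall>x y. t x x y = 0 \<and> t x y x = 0 \<and> t y x x = 0)}"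

definition affine_space_modeled_on :: "'a::real_vector set \<Rightarrow> 'a set \<Rightarrow> bool" where
  "affine_space_modeled_on A V \<longleftrightarrow>
    subspace V \<and> A \<noteq> {} \<and> (\<forall>a\<in>A. \<forall>v\<in>V. a + v \<in> A) \<and> (\<forall>a\<in>A. \<forall>b\<in>A. \<exists>!v. v \<in> V \<and> b = a + v)"

definition coset :: "'a::real_vector set \<Rightarrow> 'a \<Rightarrow> 'a set" where
  "coset W v = (\<lambda>w. v + w) ` W"

definition quotient_space :: "'a::real_vector set \<Rightarrow> 'a set \<Rightarrow> 'a set set" where
  "quotient_space V W = coset W ` V"

text \<open>\<open>\<phi>\<close> is a linear isomorphism from the quotient vector space \<open>V / W\<close> onto \<open>S\<close>.\<close>

definition quotient_iso ::
    "('a::real_vector set \<Rightarrow> 'b::real_vector) \<Rightarrow> 'a set \<Rightarrow> 'a set \<Rightarrow> 'b set \<Rightarrow> bool" where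
  "quotient_iso \<phi> V W S \<longleftrightarrow>
    subspace V \<and> subspace W \<and> W \<subseteq> V \<and> subspace S \<and>
    bij_betw \<phi> (quotient_space V W) S \<and>
    (\<forall>u\<in>V. \<forall>v\<in>V. \<phi> (coset W (u + v)) = \<phi> (coset W u) + \<phi> (coset W v)) \<and>
    (\<forall>c. \<forall>v\<in>V. \<phi> (coset W (c *\<^sub>R v)) = c *\<^sub>R \<phi> (coset W v))"

text \<open>
  The third tensor power of a subspace \<open>V\<close>, realised inside the trilinear functions on the dual
  of the ambient space: \<open>x \<otimes> y \<otimes> z\<close> is the function \<open>(f, g, h) \<mapsto> f x * g y * h z\<close>.
\<close>

definition tensor3 :: "'a::real_vector \<Rightarrow> 'a \<Rightarrow> 'a
    \<Rightarrow> 'a dual_space \<Rightarrow> 'a dual_space \<Rightarrow> 'a dual_space \<Rightarrow> real" where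
  "tensor3 x y z = (\<lambda>f g h. dual_apply f x * dual_apply g y * dual_apply h z)"

definition tensor_cube ::
    "'a::real_vector set \<Rightarrow> ('a dual_space \<Rightarrow> 'a dual_space \<Rightarrow> 'a dual_space \<Rightarrow> real) set" where
  "tensor_cube V = span {tensor3 x y z | x y z. x \<in> V \<and> y \<in> V \<and> z \<in> V}"

definition sym2_tensor ::
    "'a::real_vector set \<Rightarrow> ('a dual_space \<Rightarrow> 'a dual_space \<Rightarrow> 'a dual_space \<Rightarrow> real) set" where
  "sym2_tensor V = {\<tau> \<in> tensor_cube V. \<forall>f g h. \<tau> f g h = \<tau> g f h}"

definition sym3 ::
    "'a::real_vector set \<Rightarrow> ('a dual_space \<Rightarrow> 'a dual_space \<Rightarrow> 'a dual_space \<Rightarrow> real) set" where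
  "sym3 V = {\<tau> \<in> tensor_cube V. \<forall>f g h. \<tau> f g h = \<tau> g f h \<and> \<tau> f g h = \<tau> f h g}"


section \<open>Lie algebras and the Dorfman bracket\<close>

text \<open>
  A Lie group enters only through its Lie algebra, a finite-dimensional real Lie algebra whose
  underlying vector space is the whole type.
\<close>

definition lie_algebra :: "('a::real_vector \<Rightarrow> 'a \<Rightarrow> 'a) \<Rightarrow> bool" where
  "lie_algebra br \<longleftrightarrow>
    (\<exists>B::'a set. finite B \<and> span B = UNIV) \<and>
    bilinear br \<and> (\<forall>X. br X X = 0) \<and>
    (\<forall>X Y Z. br X (br Y Z) + br Y (br Z X) + br Z (br X Y) = 0)"

text \<open>The Chevalley--Eilenberg differential, i.e. the exterior derivative of left-invariant forms.\<close>

definition d_three_form :: "('a::real_vector \<Rightarrow> 'a \<Rightarrow> 'a) \<Rightarrow> ('a \<Rightarrow> 'a \<Rightarrow> 'a \<Rightarrow> real)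
    \<Rightarrow> 'a \<Rightarrow> 'a \<Rightarrow> 'a \<Rightarrow> 'a \<Rightarrow> real" where
  "d_three_form br H X Y Z W =
    - H (br X Y) Z W + H (br X Z) Y W - H (br X W) Y Z
    - H (br Y Z) X W + H (br Y W) X Z - H (br Z W) X Y"

type_synonym 'a gen = "'a \<times> 'a dual_space"

definition pairing :: "'a::real_vector gen \<Rightarrow> 'a gen \<Rightarrow> real" where
  "pairing u v = (dual_apply (snd u) (fst v) + dual_apply (snd v) (fst u)) / 2"

definition dorfman :: "('a::real_vector \<Rightarrow> 'a \<Rightarrow> 'a) \<Rightarrow> ('a \<Rightarrow> 'a \<Rightarrow> 'a \<Rightarrow> real)
    \<Rightarrow> 'a gen \<Rightarrow> 'a gen \<Rightarrow> 'a gen" where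
  "dorfman br H u v =
    (br (fst u) (fst v),
     Dual (\<lambda>Z. - dual_apply (snd v) (br (fst u) Z) + dual_apply (snd u) (br (fst v) Z)
               + H (fst u) (fst v) Z))"

text \<open>
  The vector representing a linear functional with respect to the scalar product; it exists
  uniquely in finite dimension, see \<open>pairing_sharp\<close> below.
\<close>

definition sharp :: "('a::real_vector gen \<Rightarrow> real) \<Rightarrow> 'a gen" where
  "sharp \<phi> = (THE x. \<forall>v. pairing x v = \<phi> v)"

definition flat :: "'a::real_vector gen \<Rightarrow> 'a gen dual_space" where
  "flat u = Dual (\<lambda>v. pairing u v)"

definition adj :: "('a::real_vector gen \<Rightarrow> 'a gen) \<Rightarrow> 'a gen \<Rightarrow> 'a gen" where
  "adj A v = sharp (\<lambda>w. pairing v (A w))"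

definition so_gen :: "('a::real_vector gen \<Rightarrow> 'a gen) set" where
  "so_gen = {A. linear A \<and> (\<forall>v w. pairing (A v) w + pairing v (A w) = 0)}"


section \<open>Generalized pseudo-Riemannian metrics\<close>

definition metric_end :: "('a::real_vector gen \<Rightarrow> 'a gen \<Rightarrow> real) \<Rightarrow> 'a gen \<Rightarrow> 'a gen" where
  "metric_end G u = sharp (G u)"

definition generalized_metric :: "('a::real_vector gen \<Rightarrow> 'a gen \<Rightarrow> real) \<Rightarrow> bool" where
  "generalized_metric G \<longleftrightarrow>
    bilinear G \<and> (\<forall>u v. G u v = G v u) \<and>
    (\<forall>u. metric_end G (metric_end G u) = u) \<and>
    (\<forall>\<xi>. (\<forall>\<eta>. G (0, \<xi>) (0, \<eta>) = 0) \<longrightarrow> \<xi> = 0)"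

definition generalized_lie_group :: "('a::real_vector \<Rightarrow> 'a \<Rightarrow> 'a) \<Rightarrow> ('a \<Rightarrow> 'a \<Rightarrow> 'a \<Rightarrow> real)
    \<Rightarrow> ('a gen \<Rightarrow> 'a gen \<Rightarrow> real) \<Rightarrow> bool" where
  "generalized_lie_group br H G \<longleftrightarrow>
    lie_algebra br \<and>
    H \<in> three_forms \<and> (\<forall>X Y Z W. d_three_form br H X Y Z W = 0) \<and>
    generalized_metric G"

text \<open>
  From here on \<open>E\<^sub>+\<close> and \<open>E\<^sub>-\<close> are treated uniformly: they are \<open>eigen G \<epsilon>\<close> for
  \<open>\<epsilon> = 1\<close> and \<open>\<epsilon> = -1\<close>.
\<close>

definition eigen :: "('a::real_vector gen \<Rightarrow> 'a gen \<Rightarrow> real) \<Rightarrow> real \<Rightarrow> 'a gen set" where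
  "eigen G \<epsilon> = {u. metric_end G u = \<epsilon> *\<^sub>R u}"


section \<open>Generalized connections\<close>

text \<open>The space \<open>E\<^sup>* \<otimes> so(E)\<close>.\<close>

definition generalized_connections :: "('a::real_vector gen \<Rightarrow> 'a gen \<Rightarrow> 'a gen) set" where
  "generalized_connections = {D. bilinear D \<and> (\<forall>u. D u \<in> so_gen)}"

definition torsion :: "('a::real_vector \<Rightarrow> 'a \<Rightarrow> 'a) \<Rightarrow> ('a \<Rightarrow> 'a \<Rightarrow> 'a \<Rightarrow> real)
    \<Rightarrow> ('a gen \<Rightarrow> 'a gen \<Rightarrow> 'a gen) \<Rightarrow> 'a gen \<Rightarrow> 'a gen \<Rightarrow> 'a gen" where
  "torsion br H D u v = D u v - D v u - dorfman br H u v + adj (\<lambda>w. D w u) v"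

definition levi_civita :: "('a::real_vector \<Rightarrow> 'a \<Rightarrow> 'a) \<Rightarrow> ('a \<Rightarrow> 'a \<Rightarrow> 'a \<Rightarrow> real)
    \<Rightarrow> ('a gen \<Rightarrow> 'a gen \<Rightarrow> real) \<Rightarrow> ('a gen \<Rightarrow> 'a gen \<Rightarrow> 'a gen) set" where
  "levi_civita br H G =
    {D \<in> generalized_connections.
       (\<forall>u v. torsion br H D u v = 0) \<and>
       (\<forall>\<epsilon>\<in>{1, -1}. \<forall>u. \<forall>v\<in>eigen G \<epsilon>. D u v \<in> eigen G \<epsilon>)}"


section \<open>The generalized first prolongation\<close>

text \<open>
  \<open>E\<^sub>\<epsilon>\<^sup>* \<otimes> so(E\<^sub>\<epsilon>)\<close> and \<open>Sym\<^sup>2 E\<^sub>\<epsilon>\<^sup>* \<otimes> E\<^sub>\<epsilon>\<^sup>*\<close> consist of maps on all of \<open>E\<close>, extended by zero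
  on the other eigenspace.
\<close>

definition eigen_so :: "('a::real_vector gen \<Rightarrow> 'a gen \<Rightarrow> real) \<Rightarrow> real
    \<Rightarrow> ('a gen \<Rightarrow> 'a gen \<Rightarrow> 'a gen) set" where
  "eigen_so G \<epsilon> =
    {\<alpha> \<in> generalized_connections.
       (\<forall>u\<in>eigen G (- \<epsilon>). \<alpha> u = 0) \<and>
       (\<forall>u. \<forall>v\<in>eigen G \<epsilon>. \<alpha> u v \<in> eigen G \<epsilon>) \<and>
       (\<forall>u. \<forall>v\<in>eigen G (- \<epsilon>). \<alpha> u v = 0)}"

definition eigen_sym2_forms :: "('a::real_vector gen \<Rightarrow> 'a gen \<Rightarrow> real) \<Rightarrow> real
    \<Rightarrow> ('a gen \<Rightarrow> 'a gen \<Rightarrow> 'a gen \<Rightarrow> real) set" where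
  "eigen_sym2_forms G \<epsilon> =
    {\<sigma>. trilinear \<sigma> \<and> (\<forall>u v w. \<sigma> u v w = \<sigma> v u w) \<and>
       (\<forall>u v w. u \<in> eigen G (- \<epsilon>) \<or> v \<in> eigen G (- \<epsilon>) \<or> w \<in> eigen G (- \<epsilon>) \<longrightarrow> \<sigma> u v w = 0)}"

definition bianchi :: "('a::real_vector gen \<Rightarrow> 'a gen \<Rightarrow> 'a gen)
    \<Rightarrow> 'a gen \<Rightarrow> 'a gen \<Rightarrow> 'a gen \<Rightarrow> real" where
  "bianchi \<alpha> = (\<lambda>u v w. pairing (\<alpha> u v) w + pairing (\<alpha> v w) u + pairing (\<alpha> w u) v)"

definition prolongation :: "('a::real_vector gen \<Rightarrow> 'a gen \<Rightarrow> real) \<Rightarrow> real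
    \<Rightarrow> ('a gen \<Rightarrow> 'a gen \<Rightarrow> 'a gen) set" where
  "prolongation G \<epsilon> = {\<alpha> \<in> eigen_so G \<epsilon>. bianchi \<alpha> = 0}"

definition alt :: "('a::real_vector gen \<Rightarrow> 'a gen \<Rightarrow> 'a gen \<Rightarrow> real)
    \<Rightarrow> 'a gen \<Rightarrow> 'a gen \<Rightarrow> 'a gen" where
  "alt \<sigma> u v = sharp (\<lambda>w. \<sigma> u v w - \<sigma> u w v)"

text \<open>
  Lowering all three indices of a tensor with the scalar product. It restricts to the
  identification of \<open>Sym\<^sup>2 E\<^sub>\<epsilon> \<otimes> E\<^sub>\<epsilon>\<close> with \<open>Sym\<^sup>2 E\<^sub>\<epsilon>\<^sup>* \<otimes> E\<^sub>\<epsilon>\<^sup>*\<close>.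
\<close>

definition lower :: "('a::real_vector gen dual_space \<Rightarrow> 'a gen dual_space \<Rightarrow> 'a gen dual_space \<Rightarrow> real)
    \<Rightarrow> 'a gen \<Rightarrow> 'a gen \<Rightarrow> 'a gen \<Rightarrow> real" where
  "lower \<tau> = (\<lambda>u v w. \<tau> (flat u) (flat v) (flat w))"


section \<open>Non-degeneracy of the scalar product\<close>

lemma pairing_ex1:
  fixes \<phi> :: "'a::real_vector gen \<Rightarrow> real"
  assumes fin: "finite (S::'a set)" "span S = UNIV" and \<phi>: "linear \<phi>"
  shows "\<exists>!x. \<forall>v. pairing x v = \<phi> v"
proof -
  obtain B where B: "B \<subseteq> S" "independent B" "S \<subseteq> span B"
    by (rule maximal_independent_subset)
  have finB: "finite B" using B(1) fin(1) by (rule finite_subset)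
  have spB: "span B = UNIV"
    using B(3) fin(2) span_minimal[OF B(3) subspace_span] by auto
  define c where "c b = Dual (\<lambda>v. representation B v b)" for b
  have lin_rep: "linear (\<lambda>v. representation B v b)" for b
    using B(2) spB by (auto simp: linear_iff representation_add representation_scale)
  have c: "dual_apply (c b) v = representation B v b" for b v
    unfolding c_def using lin_rep[of b] by (simp add: Dual_inverse)
  have rep: "(\<Sum>b\<in>B. representation B v b *\<^sub>R b) = v" for v
    using B(2) finB spB by (intro sum_representation_eq) auto
  have lin_ap: "linear (dual_apply \<eta>)" for \<eta> :: "'a dual_space"
    using dual_apply[of \<eta>] by simp
  have ap_sum: "dual_apply (\<Sum>b\<in>T. d b *\<^sub>R h b) v = (\<Sum>b\<in>T. d b * dual_apply (h b) v)"
    for T :: "'a set" and d and h :: "'a \<Rightarrow> 'a dual_space" and v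
    by (induction T rule: infinite_finite_induct)
       (simp_all add: zero_dual_space.rep_eq plus_dual_space.rep_eq scaleR_dual_space.rep_eq)
  have exp\<eta>: "\<eta> = (\<Sum>b\<in>B. dual_apply \<eta> b *\<^sub>R c b)" for \<eta>
  proof (rule dual_apply_inject[THEN iffD1], rule ext)
    fix v
    have "dual_apply \<eta> v = dual_apply \<eta> (\<Sum>b\<in>B. representation B v b *\<^sub>R b)"
      by (simp add: rep)
    also have "\<dots> = (\<Sum>b\<in>B. representation B v b * dual_apply \<eta> b)"
      using lin_ap[of \<eta>] by (simp add: linear_sum linear_scale)
    also have "\<dots> = dual_apply (\<Sum>b\<in>B. dual_apply \<eta> b *\<^sub>R c b) v"
      by (simp add: ap_sum c mult.commute)
    finally show "dual_apply \<eta> v = dual_apply (\<Sum>b\<in>B. dual_apply \<eta> b *\<^sub>R c b) v" .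
  qed
  have lin1: "linear (\<lambda>v. \<phi> (v, 0))" and lin2: "linear (\<lambda>\<eta>. \<phi> (0, \<eta>))"
    using linear_add[OF \<phi>, of "(_, 0)" "(_, 0)"] linear_scale[OF \<phi>, of _ "(_, 0)"]
      linear_add[OF \<phi>, of "(0, _)" "(0, _)"] linear_scale[OF \<phi>, of _ "(0, _)"]
    by (simp_all add: linear_iff)
  define X where "X = (\<Sum>b\<in>B. (2 * \<phi> (0, c b)) *\<^sub>R b)"
  define \<xi> where "\<xi> = Dual (\<lambda>v. 2 * \<phi> (v, 0))"
  have \<xi>: "dual_apply \<xi> v = 2 * \<phi> (v, 0)" for v
    unfolding \<xi>_def using lin1 by (subst Dual_inverse) (auto simp: linear_iff algebra_simps)
  have X: "dual_apply \<eta> X = 2 * \<phi> (0, \<eta>)" for \<eta>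
  proof -
    have "dual_apply \<eta> X = (\<Sum>b\<in>B. 2 * (dual_apply \<eta> b * \<phi> (0, c b)))"
      unfolding X_def using lin_ap[of \<eta>]
      by (simp add: linear_sum linear_scale algebra_simps)
    also have "\<dots> = 2 * \<phi> (0, \<Sum>b\<in>B. dual_apply \<eta> b *\<^sub>R c b)"
      using lin2 by (simp add: linear_sum[OF lin2] linear_scale[OF lin2] sum_distrib_left)
    finally show ?thesis unfolding exp\<eta>[symmetric] .
  qed
  have ex: "pairing (X, \<xi>) v = \<phi> v" for v
  proof -
    have "\<phi> v = \<phi> ((fst v, 0) + (0, snd v))" by simp
    also have "\<dots> = \<phi> (fst v, 0) + \<phi> (0, snd v)" using \<phi> by (rule linear_add)
    finally show ?thesis by (simp add: pairing_def X \<xi>)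
  qed
  have uniq: "x = y" if "\<forall>v. pairing x v = pairing y v" for x y :: "'a gen"
  proof -
    have "pairing x (Z, 0) = pairing y (Z, 0)" for Z using that by blast
    then have s: "snd x = snd y"
      by (intro dual_apply_inject[THEN iffD1] ext)
         (simp add: pairing_def zero_dual_space.rep_eq)
    have "pairing x (0, c b) = pairing y (0, c b)" for b using that by blast
    then have "representation B (fst x) b = representation B (fst y) b" for b
      by (simp add: pairing_def c linear_0[OF lin_ap])
    then have "(\<Sum>b\<in>B. representation B (fst x) b *\<^sub>R b) = (\<Sum>b\<in>B. representation B (fst y) b *\<^sub>R b)"
      by (intro sum.cong) auto
    then have "fst x = fst y" unfolding rep .
    with s show ?thesis by (rule prod_eqI[rotated])
  qed
  show ?thesis
  proof (rule ex1I)
    show "\<forall>v. pairing (X, \<xi>) v = \<phi> v" using ex by blast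
    show "x = (X, \<xi>)" if "\<forall>v. pairing x v = \<phi> v" for x
      using that by (intro uniq) (simp only: ex simp_thms)
  qed
qed

lemma pairing_sharp:
  assumes "lie_algebra (br :: 'a::real_vector \<Rightarrow> 'a \<Rightarrow> 'a)" "linear (\<phi> :: 'a gen \<Rightarrow> real)"
  shows "pairing (sharp \<phi>) v = \<phi> v"
proof -
  obtain S :: "'a set" where "finite S" "span S = UNIV"
    using assms(1) unfolding lie_algebra_def by blast
  from theI'[OF pairing_ex1[OF this assms(2)]] show ?thesis
    unfolding sharp_def by blast
qed

end

theory Submission
  imports Defs
begin

text \<open>
  Pairing the torsion with a third vector gives the Bianchi sum of \<open>D\<close> minus the three-form
  \<open>\<langle>[u, v]\<^sub>H, w\<rangle>\<close>, so a Levi-Civita connection is a metric connection whose Bianchi sum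
  is this form. One exists because, along the eigenspace decomposition, each component of a
  three-form can be prescribed as a component of a metric connection. The difference of two
  solutions preserves \<open>E\<^sub>\<plusminus>\<close> and has Bianchi sum zero, which kills its mixed components and
  leaves one element of \<open>\<Sigma>\<^sub>+\<close> and one of \<open>\<Sigma>\<^sub>-\<close>.
  The kernel of \<open>alt\<close> on tensors symmetric in the first two slots consists of those also
  symmetric in the last two.
\<close>

section \<open>Multilinear maps and the scalar product\<close>

lemma linear_dual_apply: "linear (dual_apply \<eta>)"
  using dual_apply[of \<eta>] by simp

lemma dual_apply_Dual: "linear f \<Longrightarrow> dual_apply (Dual f) = f"
  by (simp add: Dual_inverse)

lemma dual_apply_add: "dual_apply \<eta> (x + y) = dual_apply \<eta> x + dual_apply \<eta> y"
  by (rule linear_add[OF linear_dual_apply])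

lemma dual_apply_scaleR: "dual_apply \<eta> (c *\<^sub>R x) = c * dual_apply \<eta> x"
  by (simp add: linear_scale[OF linear_dual_apply])

lemma pairing_commute: "pairing u v = pairing v u"
  by (simp add: pairing_def)

lemma linear_pairing: "linear (pairing u)"
  by (rule linearI)
     (simp_all add: pairing_def plus_dual_space.rep_eq scaleR_dual_space.rep_eq
       dual_apply_add dual_apply_scaleR field_simps)

lemma linear_pairing_left: "linear (\<lambda>u. pairing u v)"
  using linear_pairing[of v] by (simp only: pairing_commute[of _ v])

lemmas pairing_simps =
  linear_add[OF linear_pairing] linear_add[OF linear_pairing_left]
  linear_diff[OF linear_pairing] linear_diff[OF linear_pairing_left]
  linear_neg[OF linear_pairing] linear_neg[OF linear_pairing_left]
  linear_scale[OF linear_pairing] linear_scale[OF linear_pairing_left]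
  linear_0[OF linear_pairing] linear_0[OF linear_pairing_left]

lemma scaleR_fun_apply: "(c *\<^sub>R f) x = c *\<^sub>R f x"
  by (simp add: scaleR_fun_def)

lemma bilinear_iff:
  "bilinear D \<longleftrightarrow>
    (\<forall>u u' v. D (u + u') v = D u v + D u' v) \<and> (\<forall>c u v. D (c *\<^sub>R u) v = c *\<^sub>R D u v) \<and>
    (\<forall>u v v'. D u (v + v') = D u v + D u v') \<and> (\<forall>c u v. D u (c *\<^sub>R v) = c *\<^sub>R D u v)"
  unfolding bilinear_def linear_iff by blast

lemma trilinear_iff:
  "trilinear t \<longleftrightarrow>
    (\<forall>u u' v w. t (u + u') v w = t u v w + t u' v w) \<and>
    (\<forall>c u v w. t (c *\<^sub>R u) v w = c *\<^sub>R t u v w) \<and>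
    (\<forall>u v v' w. t u (v + v') w = t u v w + t u v' w) \<and>
    (\<forall>c u v w. t u (c *\<^sub>R v) w = c *\<^sub>R t u v w) \<and>
    (\<forall>u v w w'. t u v (w + w') = t u v w + t u v w') \<and>
    (\<forall>c u v w. t u v (c *\<^sub>R w) = c *\<^sub>R t u v w)"
  unfolding trilinear_def linear_iff by (intro iffI) simp_all

lemma trilinear_compose:
  assumes "trilinear t" "linear f" "linear g" "linear h"
  shows "trilinear (\<lambda>u v w. t (f u) (g v) (h w))"
  using assms by (simp add: trilinear_iff linear_add linear_scale)

text \<open>This expands a form along a finite frame, with one index set serving all three slots;
  \<open>lower_surj\<close> uses it.\<close>

lemma trilinear_sum3:
  assumes t: "trilinear t"
  shows "t (\<Sum>i\<in>I. a i *\<^sub>R x i) (\<Sum>j\<in>I. b j *\<^sub>R y j) (\<Sum>k\<in>I. c k *\<^sub>R z k) =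
    (\<Sum>i\<in>I. \<Sum>j\<in>I. \<Sum>k\<in>I. (a i * b j * c k) *\<^sub>R t (x i) (y j) (z k))"
proof -
  have l: "linear (\<lambda>x. t x y z)" "linear (\<lambda>y. t x y z)" "linear (\<lambda>z. t x y z)" for x y z
    using t unfolding trilinear_def by auto
  let ?Y = "\<Sum>j\<in>I. b j *\<^sub>R y j" and ?Z = "\<Sum>k\<in>I. c k *\<^sub>R z k"
  have "t (\<Sum>i\<in>I. a i *\<^sub>R x i) ?Y ?Z = (\<Sum>i\<in>I. a i *\<^sub>R t (x i) ?Y ?Z)"
    by (simp only: linear_sum[OF l(1)] linear_scale[OF l(1)])
  also have "\<dots> = (\<Sum>i\<in>I. a i *\<^sub>R (\<Sum>j\<in>I. b j *\<^sub>R t (x i) (y j) ?Z))"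
    by (simp only: linear_sum[OF l(2)] linear_scale[OF l(2)])
  also have "\<dots> = (\<Sum>i\<in>I. a i *\<^sub>R (\<Sum>j\<in>I. b j *\<^sub>R (\<Sum>k\<in>I. c k *\<^sub>R t (x i) (y j) (z k))))"
    by (simp only: linear_sum[OF l(3)] linear_scale[OF l(3)])
  finally show ?thesis
    by (simp add: scaleR_sum_right mult.assoc)
qed

lemma trilinear_pairing: "bilinear D \<Longrightarrow> trilinear (\<lambda>u v w. pairing (D u v) w)"
  by (simp add: trilinear_iff bilinear_iff pairing_simps)

lemma bianchi_add: "bianchi (\<alpha> + \<beta>) = bianchi \<alpha> + bianchi \<beta>"
  by (simp add: bianchi_def fun_eq_iff pairing_simps)

lemma bianchi_diff: "bianchi (\<alpha> - \<beta>) = bianchi \<alpha> - bianchi \<beta>"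
  by (simp add: bianchi_def fun_eq_iff pairing_simps)

lemma bianchi_scaleR: "bianchi (c *\<^sub>R \<alpha>) = c *\<^sub>R bianchi \<alpha>"
  by (simp add: bianchi_def fun_eq_iff pairing_simps scaleR_fun_apply algebra_simps)

lemma generalized_connections_skew:
  "D \<in> generalized_connections \<Longrightarrow> pairing (D u v) w = - pairing (D u w) v"
  unfolding generalized_connections_def so_gen_def eq_neg_iff_add_eq_0 pairing_commute[of _ v]
  by blast

lemma generalized_connections_bilinear: "D \<in> generalized_connections \<Longrightarrow> bilinear D"
  by (simp add: generalized_connections_def)

lemma generalized_connectionsI:
  assumes "bilinear D" "\<And>u v w. pairing (D u v) w = - pairing (D u w) v"
  shows "D \<in> generalized_connections"
proof -
  have "pairing (D u v) w + pairing v (D u w) = 0" for u v w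
    using assms(2)[of u v w] pairing_commute[of v "D u w"] by linarith
  then show ?thesis
    using assms(1) unfolding generalized_connections_def so_gen_def bilinear_def by blast
qed

lemma subspace_generalized_connections: "subspace generalized_connections"
proof (rule subspaceI)
  show "0 \<in> generalized_connections"
    by (rule generalized_connectionsI) (auto simp: bilinear_iff pairing_simps)
next
  fix \<alpha> \<beta> :: "'a gen \<Rightarrow> 'a gen \<Rightarrow> 'a gen" and c :: real
  assume \<alpha>: "\<alpha> \<in> generalized_connections"
  note skew\<alpha> = generalized_connections_skew[OF \<alpha>]
  note bil\<alpha> = generalized_connections_bilinear[OF \<alpha>]
  show "c *\<^sub>R \<alpha> \<in> generalized_connections"
  proof (rule generalized_connectionsI)
    show "bilinear (c *\<^sub>R \<alpha>)"
      using bil\<alpha> by (simp add: bilinear_iff scaleR_fun_apply algebra_simps)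
    show "pairing ((c *\<^sub>R \<alpha>) u v) w = - pairing ((c *\<^sub>R \<alpha>) u w) v" for u v w
      using skew\<alpha>[of u v w] by (simp add: scaleR_fun_apply pairing_simps)
  qed
  assume \<beta>: "\<beta> \<in> generalized_connections"
  note skew\<beta> = generalized_connections_skew[OF \<beta>]
  note bil\<beta> = generalized_connections_bilinear[OF \<beta>]
  show "\<alpha> + \<beta> \<in> generalized_connections"
  proof (rule generalized_connectionsI)
    show "bilinear (\<alpha> + \<beta>)"
      using bil\<alpha> bil\<beta> by (simp add: bilinear_iff algebra_simps)
    show "pairing ((\<alpha> + \<beta>) u v) w = - pairing ((\<alpha> + \<beta>) u w) v" for u v w
      using skew\<alpha>[of u v w] skew\<beta>[of u v w] by (simp add: pairing_simps)
  qed
qed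

text \<open>When two arguments agree, skewness makes two of the cyclic terms cancel, and the third
  has the shape \<open>pairing (D w u) u\<close>, which is zero.\<close>

lemma bianchi_three_form:
  assumes "D \<in> generalized_connections"
  shows "bianchi D \<in> three_forms"
proof -
  note skew = generalized_connections_skew[OF assms]
  have "trilinear (bianchi D)"
    using trilinear_pairing[OF generalized_connections_bilinear[OF assms]]
    by (simp add: trilinear_iff bianchi_def algebra_simps)
  moreover have "bianchi D u u w = 0" "bianchi D u w u = 0" "bianchi D w u u = 0" for u w
    using skew[of u u w] skew[of w u u] by (simp_all add: bianchi_def)
  ultimately show ?thesis
    by (simp add: three_forms_def)
qed

text \<open>Polarisation: a sum is put into two adjacent slots.\<close>

lemma three_forms_skew:
  assumes "t \<in> three_forms"
  shows "t u v w = - t v u w" "t u v w = - t u w v"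
proof -
  have t: "trilinear t" and z: "t x x y = 0" "t y x x = 0" for x y
    using assms by (auto simp: three_forms_def)
  show "t u v w = - t v u w"
    using z(1)[of "u + v" w] z(1)[of u w] z(1)[of v w] t by (simp add: trilinear_iff)
  show "t u v w = - t u w v"
    using z(2)[of u "v + w"] z(2)[of u v] z(2)[of u w] t by (simp add: trilinear_iff)
qed

section \<open>Quotients by a subspace\<close>

lemma coset_eq_iff:
  assumes "subspace W"
  shows "coset W u = coset W v \<longleftrightarrow> u - v \<in> W"
proof
  assume "coset W u = coset W v"
  moreover have "u \<in> coset W u"
    unfolding coset_def using subspace_0[OF assms] by force
  ultimately show "u - v \<in> W" by (auto simp: coset_def)
next
  have sub: "coset W u \<subseteq> coset W v" if "u - v \<in> W" for u v
  proof
    fix x assume "x \<in> coset W u"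
    then obtain w where w: "w \<in> W" "x = u + w" by (auto simp: coset_def)
    then have "x = v + ((u - v) + w)" by simp
    then show "x \<in> coset W v"
      unfolding coset_def using subspace_add[OF assms that w(1)] by blast
  qed
  assume "u - v \<in> W"
  moreover from this have "v - u \<in> W" using subspace_neg[OF assms] by fastforce
  ultimately show "coset W u = coset W v" using sub by blast
qed

text \<open>The first isomorphism theorem for a map that is linear only on \<open>V\<close>. This
  generality matters for \<open>alt\<close>, which is built from \<open>sharp\<close> and so is
  controlled only where the functionals are linear.\<close>

lemma quotient_iso_from_linear:
  fixes f :: "'a::real_vector \<Rightarrow> 'b::real_vector"
  assumes V: "subspace V" and W: "subspace W" "W \<subseteq> V" and S: "subspace S" "f ` V = S"
    and add: "\<And>u v. u \<in> V \<Longrightarrow> v \<in> V \<Longrightarrow> f (u + v) = f u + f v"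
    and scale: "\<And>c v. v \<in> V \<Longrightarrow> f (c *\<^sub>R v) = c *\<^sub>R f v"
    and ker: "\<And>v. v \<in> V \<Longrightarrow> f v = 0 \<longleftrightarrow> v \<in> W"
  shows "\<exists>\<phi>. quotient_iso \<phi> V W S \<and> (\<forall>v\<in>V. \<phi> (coset W v) = f v)"
proof -
  have eq: "f u = f v \<longleftrightarrow> coset W u = coset W v" if "u \<in> V" "v \<in> V" for u v
  proof -
    have "f (u - v) = f u - f v"
      using add[of u "(-1) *\<^sub>R v"] scale[of v "-1"] subspace_scale[OF V, of v "-1"] that by simp
    then show ?thesis
      using ker[of "u - v"] subspace_diff[OF V that] coset_eq_iff[OF W(1), of u v] by simp
  qed
  \<comment> \<open>A representative is chosen in each coset; by \<open>eq\<close> the value of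
    \<open>f\<close> does not depend on the choice.\<close>
  define \<phi> where "\<phi> C = f (SOME v. v \<in> V \<and> coset W v = C)" for C
  have \<phi>: "\<phi> (coset W v) = f v" if "v \<in> V" for v
  proof -
    have "(SOME u. u \<in> V \<and> coset W u = coset W v) \<in> V \<and>
        coset W (SOME u. u \<in> V \<and> coset W u = coset W v) = coset W v"
      by (rule someI[of _ v]) (simp add: that)
    then show ?thesis unfolding \<phi>_def using eq that by blast
  qed
  have "bij_betw \<phi> (quotient_space V W) S"
    unfolding bij_betw_def inj_on_def quotient_space_def
    using \<phi> eq S(2) by (auto simp: image_image)
  then have "quotient_iso \<phi> V W S"
    unfolding quotient_iso_def
    using V W S(1) \<phi> add scale subspace_add[OF V] subspace_scale[OF V] by simp
  with \<phi> show ?thesis by blast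
qed

section \<open>Spaces of symmetric tensors\<close>

lemma tensor_cube_trilinear: "\<tau> \<in> tensor_cube V \<Longrightarrow> trilinear \<tau>"
  unfolding tensor_cube_def
proof (induction rule: span_induct_alt)
  case base
  show ?case by (simp add: trilinear_iff)
next
  case (step c x y)
  then show ?case
    by (auto simp: trilinear_iff tensor3_def scaleR_fun_apply plus_dual_space.rep_eq
        scaleR_dual_space.rep_eq algebra_simps)
qed

lemma subspace_sym2_tensor: "subspace (sym2_tensor V)"
  unfolding sym2_tensor_def tensor_cube_def
  by (rule subspaceI) (auto intro: span_zero span_add span_scale simp: scaleR_fun_apply)

lemma subspace_sym3: "subspace (sym3 V)"
  unfolding sym3_def tensor_cube_def
  by (rule subspaceI) (auto intro: span_zero span_add span_scale simp: scaleR_fun_apply)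

declare split_paired_All [simp del]

section \<open>Frames and index raising in finite dimension\<close>

locale finite_dim_lie_algebra =
  fixes br :: "'a::real_vector \<Rightarrow> 'a \<Rightarrow> 'a"
  assumes lie: "lie_algebra br"
begin

text \<open>Non-degeneracy, as the uniqueness half of \<open>pairing_ex1\<close> for the functional
  \<open>pairing y\<close>. Vectors known only through \<open>sharp\<close> are compared this way
  throughout.\<close>

lemma pairing_eqI:
  fixes x y :: "'a gen"
  assumes "\<And>w. pairing x w = pairing y w"
  shows "x = y"
proof -
  obtain S :: "'a set" where "finite S" "span S = UNIV"
    using lie unfolding lie_algebra_def by blast
  from pairing_ex1[OF this linear_pairing[of y]] show ?thesis
    using assms by blast
qed

lemma pairing_sharp_left:
  "linear (\<phi> :: 'a gen \<Rightarrow> real) \<Longrightarrow> pairing (sharp \<phi>) v = \<phi> v"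
  by (rule pairing_sharp[OF lie])

lemma pairing_adj:
  fixes A :: "'a gen \<Rightarrow> 'a gen"
  assumes "linear A"
  shows "pairing (adj A v) w = pairing v (A w)"
  unfolding adj_def
  using linear_compose[OF assms linear_pairing[of v]] by (simp add: pairing_sharp_left o_def)

lemma flat_apply: "dual_apply (flat u) v = pairing u (v :: 'a gen)"
  by (simp add: flat_def dual_apply_Dual linear_pairing)

text \<open>Surjectivity of \<open>flat\<close>: an identity for \<open>lower \<tau>\<close> at all
  vectors becomes one for \<open>\<tau>\<close> at all covectors.\<close>

lemma flat_sharp: "flat (sharp (dual_apply f)) = (f :: 'a gen dual_space)"
  by (rule dual_apply_inject[THEN iffD1])
     (simp add: fun_eq_iff flat_apply pairing_sharp_left linear_dual_apply)

lemma linear_flat: "linear (flat :: 'a gen \<Rightarrow> _)"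
  by (rule linearI; rule dual_apply_inject[THEN iffD1])
     (simp_all add: fun_eq_iff flat_apply pairing_simps plus_dual_space.rep_eq scaleR_dual_space.rep_eq)

lemma pairing_sharp_trilinear:
  fixes t :: "'a gen \<Rightarrow> 'a gen \<Rightarrow> 'a gen \<Rightarrow> real"
  assumes "trilinear t"
  shows "pairing (sharp (t u v)) w = t u v w"
  using assms by (intro pairing_sharp_left) (simp add: trilinear_def)

lemma bilinear_sharp:
  fixes t :: "'a gen \<Rightarrow> 'a gen \<Rightarrow> 'a gen \<Rightarrow> real"
  assumes "trilinear t"
  shows "bilinear (\<lambda>u v. sharp (t u v))"
  using assms unfolding bilinear_iff
  by (intro conjI allI pairing_eqI)
     (simp_all add: pairing_sharp_trilinear[OF assms] pairing_simps trilinear_iff)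

text \<open>Both \<open>alt \<sigma>\<close> and the connection in the existence proof arise by
  raising the last index of a form that is skew in its last two slots.\<close>

lemma sharp_generalized_connection:
  fixes t :: "'a gen \<Rightarrow> 'a gen \<Rightarrow> 'a gen \<Rightarrow> real"
  assumes "trilinear t" "\<And>u v w. t u v w = - t u w v"
  shows "(\<lambda>u v. sharp (t u v)) \<in> generalized_connections"
proof (rule generalized_connectionsI)
  show "pairing (sharp (t u v)) w = - pairing (sharp (t u w)) v" for u v w
    unfolding pairing_sharp_trilinear[OF assms(1)] by (rule assms(2))
qed (rule bilinear_sharp[OF assms(1)])

text \<open>The vectors \<open>q i\<close> are a basis of the Lie algebra together with its dual
  basis, whence the sum type of indices; the \<open>p i\<close> read off the coordinates.\<close>

lemma finite_frame:
  obtains I :: "('a + 'a) set" and p q :: "'a + 'a \<Rightarrow> 'a gen"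
  where "finite I" "\<And>u. u = (\<Sum>i\<in>I. pairing (p i) u *\<^sub>R q i)"
proof -
  obtain S :: "'a set" where S: "finite S" "span S = UNIV"
    using lie unfolding lie_algebra_def by blast
  obtain B where B: "B \<subseteq> S" "independent B" "S \<subseteq> span B"
    by (rule maximal_independent_subset)
  have fin: "finite B" using B(1) S(1) by (rule finite_subset)
  have span: "span B = UNIV"
    using B(3) S(2) span_minimal[OF B(3) subspace_span] by auto
  define c where "c b = Dual (\<lambda>v. representation B v b)" for b
  have c: "dual_apply (c b) v = representation B v b" for b v
    unfolding c_def using B(2) span
    by (subst dual_apply_Dual) (auto simp: linear_iff representation_add representation_scale)
  have rep: "(\<Sum>b\<in>B. representation B v b *\<^sub>R b) = v" for v
    using B(2) fin span by (intro sum_representation_eq) auto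
  have dual_sum: "dual_apply (\<Sum>b\<in>T. d b *\<^sub>R c b) v = (\<Sum>b\<in>T. d b * dual_apply (c b) v)"
    for T d v
    by (induction T rule: infinite_finite_induct)
       (simp_all add: zero_dual_space.rep_eq plus_dual_space.rep_eq scaleR_dual_space.rep_eq)
  have dual_rep: "(\<Sum>b\<in>B. dual_apply \<eta> b *\<^sub>R c b) = \<eta>" for \<eta>
  proof (rule dual_apply_inject[THEN iffD1], rule ext)
    fix v
    have "dual_apply \<eta> v = dual_apply \<eta> (\<Sum>b\<in>B. representation B v b *\<^sub>R b)"
      by (simp add: rep)
    also have "\<dots> = (\<Sum>b\<in>B. representation B v b * dual_apply \<eta> b)"
      by (simp add: linear_sum[OF linear_dual_apply] dual_apply_scaleR)
    finally show "dual_apply (\<Sum>b\<in>B. dual_apply \<eta> b *\<^sub>R c b) v = dual_apply \<eta> v"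
      by (simp add: dual_sum c mult.commute)
  qed
  \<comment> \<open>The two summands of \<open>E\<close> are isotropic and paired with each other,
    so \<open>p\<close> swaps them; the factor 2 cancels the one half in
    \<open>pairing\<close>.\<close>
  define p where "p = case_sum (\<lambda>b::'a. (0::'a, 2 *\<^sub>R c b)) (\<lambda>b. (2 *\<^sub>R b, 0::'a dual_space))"
  define q where "q = case_sum (\<lambda>b::'a. (b, 0)) (\<lambda>b. (0, c b))"
  have "u = (\<Sum>i\<in>B <+> B. pairing (p i) u *\<^sub>R q i)" for u
  proof -
    have "(\<Sum>i\<in>B <+> B. pairing (p i) u *\<^sub>R q i) =
        (\<Sum>b\<in>B. (representation B (fst u) b *\<^sub>R b, 0)) + (\<Sum>b\<in>B. (0, dual_apply (snd u) b *\<^sub>R c b))"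
      using fin by (simp add: sum.Plus p_def q_def pairing_def scaleR_dual_space.rep_eq
          zero_dual_space.rep_eq dual_apply_scaleR c linear_0[OF linear_dual_apply])
    also have "\<dots> = u"
      by (simp add: prod_eq_iff fst_sum snd_sum rep dual_rep)
    finally show ?thesis by simp
  qed
  with fin show thesis by (intro that[of "B <+> B" p q]) auto
qed

end

section \<open>The eigenspace decomposition\<close>

locale gen_lie_group = finite_dim_lie_algebra br
  for br :: "'a::real_vector \<Rightarrow> 'a \<Rightarrow> 'a" +
  fixes H :: "'a \<Rightarrow> 'a \<Rightarrow> 'a \<Rightarrow> real"
    and G :: "'a gen \<Rightarrow> 'a gen \<Rightarrow> real"
  assumes H: "H \<in> three_forms" and G: "generalized_metric G"
begin

lemma pairing_metric_end: "pairing (metric_end G u) v = G u v"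
  using G unfolding metric_end_def generalized_metric_def bilinear_def
  by (intro pairing_sharp_left) blast

lemma metric_end_involution: "metric_end G (metric_end G u) = u"
  using G by (simp add: generalized_metric_def)

text \<open>This is the symmetry of \<open>G\<close> read through the scalar product. It passes to
  \<open>proj\<close> and makes the eigenspaces orthogonal.\<close>

lemma metric_end_self_adjoint: "pairing (metric_end G u) v = pairing u (metric_end G v)"
  using G by (metis pairing_metric_end pairing_commute generalized_metric_def)

lemma linear_metric_end: "linear (metric_end G)"
  using G by (intro linearI pairing_eqI)
    (simp_all add: pairing_metric_end pairing_simps generalized_metric_def bilinear_iff)

text \<open>For \<epsilon> equal to 1 or -1, the spectral projection of the involution onto
  \<open>E\<^sub>\<epsilon>\<close> along the other eigenspace.\<close>

definition proj :: "real \<Rightarrow> 'a gen \<Rightarrow> 'a gen" where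
  "proj \<epsilon> u = (1/2) *\<^sub>R (u + \<epsilon> *\<^sub>R metric_end G u)"

lemma linear_proj: "linear (proj \<epsilon>)"
  by (rule linearI)
     (simp_all add: proj_def linear_add[OF linear_metric_end] linear_scale[OF linear_metric_end]
       algebra_simps)

lemma proj_sum: "proj \<epsilon> u + proj (- \<epsilon>) u = u"
  by (simp add: proj_def algebra_simps flip: scaleR_left_distrib)

lemma proj_self_adjoint: "pairing (proj \<epsilon> u) v = pairing u (proj \<epsilon> v)"
  by (simp add: proj_def pairing_simps metric_end_self_adjoint)

lemma subspace_eigen: "subspace (eigen G \<epsilon>)"
  unfolding eigen_def
  by (rule subspaceI)
     (simp_all add: linear_0[OF linear_metric_end] linear_add[OF linear_metric_end]
       linear_scale[OF linear_metric_end] algebra_simps)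

lemma proj_in_eigen: "\<epsilon> \<in> {1, -1} \<Longrightarrow> proj \<epsilon> u \<in> eigen G \<epsilon>"
  by (auto simp: eigen_def proj_def linear_add[OF linear_metric_end] linear_diff[OF linear_metric_end]
      linear_scale[OF linear_metric_end] metric_end_involution algebra_simps)

lemma proj_eigen: "\<epsilon> \<in> {1, -1} \<Longrightarrow> u \<in> eigen G \<epsilon> \<Longrightarrow> proj \<epsilon> u = u"
  by (auto simp: eigen_def proj_def simp flip: scaleR_left_distrib)

lemma proj_eigen_opposite: "\<epsilon> \<in> {1, -1} \<Longrightarrow> u \<in> eigen G (- \<epsilon>) \<Longrightarrow> proj \<epsilon> u = 0"
  by (auto simp: eigen_def proj_def)

lemma eigen_orthogonal:
  assumes "\<epsilon> \<in> {1, -1}" "u \<in> eigen G \<epsilon>" "v \<in> eigen G (- \<epsilon>)"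
  shows "pairing u v = 0"
  using proj_self_adjoint[of \<epsilon> u v] proj_eigen[OF assms(1,2)] proj_eigen_opposite[OF assms(1,3)]
  by (simp add: pairing_simps)

text \<open>An eigenspace is the full orthogonal complement of the other one: the self-adjoint
  projection moves onto the test vector, and non-degeneracy removes the unwanted component.\<close>

lemma eigen_memI:
  assumes "\<epsilon> \<in> {1, -1}" "\<And>w. w \<in> eigen G (- \<epsilon>) \<Longrightarrow> pairing u w = 0"
  shows "u \<in> eigen G \<epsilon>"
proof -
  have "pairing (proj (- \<epsilon>) u) w = 0" for w
    unfolding proj_self_adjoint using assms(1) by (intro assms(2) proj_in_eigen) auto
  then have "proj (- \<epsilon>) u = 0"
    by (intro pairing_eqI) (simp add: pairing_simps)
  then show ?thesis
    using proj_sum[of \<epsilon> u] proj_in_eigen[OF assms(1), of u] by simp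
qed

text \<open>Of the eight terms obtained by splitting each argument, seven contain a vector of the
  opposite eigenspace.\<close>

lemma trilinear_vanish_proj:
  assumes t: "trilinear t"
    and z: "\<And>u v w. u \<in> eigen G (- \<epsilon>) \<or> v \<in> eigen G (- \<epsilon>) \<or> w \<in> eigen G (- \<epsilon>) \<Longrightarrow> t u v w = 0"
    and \<epsilon>: "\<epsilon> \<in> {1, -1}"
  shows "t (proj \<epsilon> u) (proj \<epsilon> v) (proj \<epsilon> w) = t u v w"
proof -
  have e: "proj (- \<epsilon>) x \<in> eigen G (- \<epsilon>)" for x
    using \<epsilon> by (intro proj_in_eigen) auto
  have "t u v w = t (proj \<epsilon> u + proj (- \<epsilon>) u) (proj \<epsilon> v + proj (- \<epsilon>) v) (proj \<epsilon> w + proj (- \<epsilon>) w)"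
    by (simp only: proj_sum)
  also have "\<dots> = t (proj \<epsilon> u) (proj \<epsilon> v) (proj \<epsilon> w)"
    using t by (simp add: trilinear_iff z e)
  finally show ?thesis by simp
qed

end

section \<open>The generalized first prolongation\<close>

context gen_lie_group
begin

lemma subspace_eigen_so: "subspace (eigen_so G \<epsilon>)"
  unfolding eigen_so_def
  using subspace_generalized_connections subspace_eigen[of \<epsilon>]
  by (auto simp: subspace_def scaleR_fun_apply)

lemma subspace_prolongation: "subspace (prolongation G \<epsilon>)"
proof -
  have "bianchi (0 :: 'a gen \<Rightarrow> 'a gen \<Rightarrow> 'a gen) = 0"
    by (simp add: bianchi_def fun_eq_iff pairing_simps)
  then show ?thesis
    using subspace_eigen_so[of \<epsilon>] unfolding prolongation_def subspace_def
    by (simp add: bianchi_add bianchi_scaleR)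
qed

text \<open>A common element vanishes whenever its first argument lies in either eigenspace, and
  these span \<open>E\<close>.\<close>

lemma prolongation_inter: "prolongation G 1 \<inter> prolongation G (- 1) = {0}"
proof -
  have "\<alpha> = 0" if "\<alpha> \<in> prolongation G 1" "\<alpha> \<in> prolongation G (- 1)" for \<alpha>
  proof (intro ext)
    fix u v
    have z: "\<alpha> (proj 1 u) = 0" "\<alpha> (proj (- 1) u) = 0"
      using that proj_in_eigen[of 1 u] proj_in_eigen[of "- 1" u]
      by (auto simp: prolongation_def eigen_so_def)
    have "bilinear \<alpha>"
      using that by (auto simp: prolongation_def eigen_so_def generalized_connections_def)
    then have "\<alpha> (proj 1 u + proj (- 1) u) v = \<alpha> (proj 1 u) v + \<alpha> (proj (- 1) u) v"
      by (simp add: bilinear_iff)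
    then show "\<alpha> u v = 0 u v" using z by (simp add: proj_sum)
  qed
  then show ?thesis
    using subspace_0[OF subspace_prolongation[of 1]] subspace_0[OF subspace_prolongation[of "- 1"]]
    by auto
qed

section \<open>The alternation map and its image\<close>

lemma trilinear_alt_form:
  assumes "trilinear (\<sigma> :: 'a gen \<Rightarrow> 'a gen \<Rightarrow> 'a gen \<Rightarrow> real)"
  shows "trilinear (\<lambda>u v w. \<sigma> u v w - \<sigma> u w v)"
  using assms by (simp add: trilinear_iff algebra_simps)

lemma pairing_alt:
  assumes "trilinear (\<sigma> :: 'a gen \<Rightarrow> 'a gen \<Rightarrow> 'a gen \<Rightarrow> real)"
  shows "pairing (alt \<sigma> u v) w = \<sigma> u v w - \<sigma> u w v"
  unfolding alt_def by (rule pairing_sharp_trilinear[OF trilinear_alt_form[OF assms]])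

text \<open>After pairing, each support condition says that \<sigma> vanishes at an argument from
  the opposite eigenspace; membership of the values goes through \<open>eigen_memI\<close>.\<close>

lemma alt_eigen_so:
  assumes \<epsilon>: "\<epsilon> \<in> {1, -1}" and \<sigma>: "\<sigma> \<in> eigen_sym2_forms G \<epsilon>"
  shows "alt \<sigma> \<in> eigen_so G \<epsilon>"
proof -
  have t: "trilinear \<sigma>"
    and z: "u \<in> eigen G (- \<epsilon>) \<or> v \<in> eigen G (- \<epsilon>) \<or> w \<in> eigen G (- \<epsilon>) \<Longrightarrow> \<sigma> u v w = 0" for u v w
    using \<sigma> by (auto simp: eigen_sym2_forms_def)
  have "alt \<sigma> \<in> generalized_connections"
    unfolding alt_def by (rule sharp_generalized_connection[OF trilinear_alt_form[OF t]]) simp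
  moreover have "alt \<sigma> u = 0" if "u \<in> eigen G (- \<epsilon>)" for u
    using that by (intro ext pairing_eqI) (simp add: pairing_alt[OF t] pairing_simps z)
  moreover have "alt \<sigma> u v \<in> eigen G \<epsilon>" for u v
    by (rule eigen_memI[OF \<epsilon>]) (simp add: pairing_alt[OF t] z)
  moreover have "alt \<sigma> u v = 0" if "v \<in> eigen G (- \<epsilon>)" for u v
    using that by (intro pairing_eqI) (simp add: pairing_alt[OF t] pairing_simps z)
  ultimately show ?thesis by (simp add: eigen_so_def)
qed

text \<open>The six terms of the cyclic sum cancel in pairs by the symmetry of \<sigma> in its first
  two slots.\<close>

lemma alt_prolongation:
  assumes \<epsilon>: "\<epsilon> \<in> {1, -1}" and \<sigma>: "\<sigma> \<in> eigen_sym2_forms G \<epsilon>"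
  shows "alt \<sigma> \<in> prolongation G \<epsilon>"
proof -
  have t: "trilinear \<sigma>" and s: "\<And>u v w. \<sigma> u v w = \<sigma> v u w"
    using \<sigma> by (auto simp: eigen_sym2_forms_def)
  have "bianchi (alt \<sigma>) u v w = 0" for u v w
    unfolding bianchi_def pairing_alt[OF t] using s[of u v w] s[of v w u] s[of w u v] by simp
  then show ?thesis
    using alt_eigen_so[OF assms] by (simp add: prolongation_def fun_eq_iff)
qed

text \<open>
  A preimage of \<open>\<alpha>\<close> under \<open>alt\<close> is one third of the symmetrisation of \<open>\<langle>\<alpha>\<^sub>u v, w\<rangle>\<close> in
  \<open>u\<close> and \<open>v\<close>: the Bianchi identity and skewness turn its alternation into \<open>\<alpha>\<close>.
\<close>

lemma prolongation_subset_alt: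
  assumes \<epsilon>: "\<epsilon> \<in> {1, -1}" and \<alpha>: "\<alpha> \<in> prolongation G \<epsilon>"
  shows "\<alpha> \<in> alt ` eigen_sym2_forms G \<epsilon>"
proof -
  have gc: "\<alpha> \<in> generalized_connections"
    and z1: "\<And>u v. u \<in> eigen G (- \<epsilon>) \<Longrightarrow> \<alpha> u v = 0"
    and z2: "\<And>u v. v \<in> eigen G (- \<epsilon>) \<Longrightarrow> \<alpha> u v = 0"
    and "bianchi \<alpha> = 0"
    using \<alpha> by (auto simp: prolongation_def eigen_so_def)
  then have b: "pairing (\<alpha> u v) w + pairing (\<alpha> v w) u + pairing (\<alpha> w u) v = 0" for u v w
    by (simp add: bianchi_def fun_eq_iff)
  note skew = generalized_connections_skew[OF gc]
  define \<sigma> where "\<sigma> u v w = (pairing (\<alpha> u v) w + pairing (\<alpha> v u) w) / 3" for u v w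
  have t: "trilinear \<sigma>"
    using trilinear_pairing[OF generalized_connections_bilinear[OF gc]]
    by (simp add: trilinear_iff \<sigma>_def field_simps)
  \<comment> \<open>The support conditions on \<alpha> concern its two arguments; skewness moves
    \<open>w\<close> from the pairing into the second one.\<close>
  have "\<sigma> u v w = 0" if "w \<in> eigen G (- \<epsilon>)" for u v w
    using skew[of u v w] skew[of v u w] by (simp add: \<sigma>_def z2[OF that] pairing_simps)
  then have "\<sigma> \<in> eigen_sym2_forms G \<epsilon>"
    using t z1 z2 by (auto simp: eigen_sym2_forms_def \<sigma>_def pairing_simps)
  moreover have "alt \<sigma> = \<alpha>"
  proof (intro ext pairing_eqI)
    fix u v w
    \<comment> \<open>By skewness the left side is twice \<open>pairing (\<alpha> u v) w\<close>
      minus the two other cyclic terms, and the Bianchi identity turns these into a third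
      copy.\<close>
    have "3 * pairing (alt \<sigma> u v) w = 3 * pairing (\<alpha> u v) w"
      using b[of u v w] skew[of u v w] skew[of v u w] skew[of w u v]
      by (simp add: pairing_alt[OF t] \<sigma>_def field_simps)
    then show "pairing (alt \<sigma> u v) w = pairing (\<alpha> u v) w" by simp
  qed
  ultimately show ?thesis by blast
qed

lemma prolongation_eq_alt:
  "\<epsilon> \<in> {1, -1} \<Longrightarrow> prolongation G \<epsilon> = alt ` eigen_sym2_forms G \<epsilon>"
  using alt_prolongation prolongation_subset_alt by blast

section \<open>Tensors on an eigenspace as forms\<close>

text \<open>A pure tensor lowers to a product of three pairings with vectors of
  \<open>E\<^sub>\<epsilon>\<close>, one of which is zero by orthogonality.\<close>

lemma lower_tensor_cube_vanishes:
  assumes \<epsilon>: "\<epsilon> \<in> {1, -1}" and \<tau>: "\<tau> \<in> tensor_cube (eigen G \<epsilon>)"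
    and z: "u \<in> eigen G (- \<epsilon>) \<or> v \<in> eigen G (- \<epsilon>) \<or> w \<in> eigen G (- \<epsilon>)"
  shows "lower \<tau> u v w = 0"
  using \<tau> unfolding tensor_cube_def
proof (induction rule: span_induct_alt)
  case base
  show ?case by (simp add: lower_def)
next
  case (step c x y)
  then obtain a b d where x: "x = tensor3 a b d"
    and e: "a \<in> eigen G \<epsilon>" "b \<in> eigen G \<epsilon>" "d \<in> eigen G \<epsilon>" by auto
  have "lower x u v w = 0"
    using z e
    by (elim disjE) (simp_all add: x lower_def tensor3_def flat_apply pairing_commute[of _ a]
        pairing_commute[of _ b] pairing_commute[of _ d] eigen_orthogonal[OF \<epsilon>])
  then show ?case using step.IH by (simp add: lower_def scaleR_fun_apply)
qed

lemma trilinear_lower: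
  "\<tau> \<in> tensor_cube V \<Longrightarrow> trilinear (lower \<tau> :: 'a gen \<Rightarrow> 'a gen \<Rightarrow> 'a gen \<Rightarrow> real)"
  unfolding lower_def
  by (rule trilinear_compose[OF tensor_cube_trilinear linear_flat linear_flat linear_flat])

lemma lower_eigen_sym2_forms:
  assumes "\<epsilon> \<in> {1, -1}" "\<tau> \<in> sym2_tensor (eigen G \<epsilon>)"
  shows "lower \<tau> \<in> eigen_sym2_forms G \<epsilon>"
proof -
  have \<tau>: "\<tau> \<in> tensor_cube (eigen G \<epsilon>)" "\<And>f g h. \<tau> f g h = \<tau> g f h"
    using assms(2) by (auto simp: sym2_tensor_def)
  have "lower \<tau> u v w = lower \<tau> v u w" for u v w
    unfolding lower_def by (rule \<tau>(2))
  then show ?thesis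
    using trilinear_lower[OF \<tau>(1)] lower_tensor_cube_vanishes[OF assms(1) \<tau>(1)]
    unfolding eigen_sym2_forms_def by blast
qed

text \<open>The preimage is \<sigma> with its indices raised. The point is to write it as a finite
  sum of pure tensors of vectors in \<open>E\<^sub>\<epsilon>\<close>, which a projected frame
  supplies.\<close>

lemma lower_surj:
  assumes \<epsilon>: "\<epsilon> \<in> {1, -1}" and \<sigma>: "\<sigma> \<in> eigen_sym2_forms G \<epsilon>"
  obtains \<tau> where "\<tau> \<in> sym2_tensor (eigen G \<epsilon>)" "lower \<tau> = \<sigma>"
proof -
  have t: "trilinear \<sigma>" and s: "\<And>u v w. \<sigma> u v w = \<sigma> v u w"
    and z: "\<And>u v w. u \<in> eigen G (- \<epsilon>) \<or> v \<in> eigen G (- \<epsilon>) \<or> w \<in> eigen G (- \<epsilon>) \<Longrightarrow> \<sigma> u v w = 0"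
    using \<sigma> by (auto simp: eigen_sym2_forms_def)
  obtain I :: "('a + 'a) set" and p q :: "'a + 'a \<Rightarrow> 'a gen"
    where I: "finite I" "\<And>u. u = (\<Sum>i\<in>I. pairing (p i) u *\<^sub>R q i)"
    by (rule finite_frame) blast
  \<comment> \<open>Self-adjointness moves the projection from \<open>u\<close> to the frame vector,
    which then lies in \<open>E\<^sub>\<epsilon>\<close>.\<close>
  have proj_frame: "proj \<epsilon> u = (\<Sum>i\<in>I. pairing (proj \<epsilon> (p i)) u *\<^sub>R q i)" for u
    using I(2)[of "proj \<epsilon> u"] by (simp add: proj_self_adjoint)
  have frame: "\<sigma> (proj \<epsilon> u) (proj \<epsilon> v) (proj \<epsilon> w) = (\<Sum>i\<in>I. \<Sum>j\<in>I. \<Sum>k\<in>I.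
      (pairing (proj \<epsilon> (p i)) u * pairing (proj \<epsilon> (p j)) v * pairing (proj \<epsilon> (p k)) w) *\<^sub>R
        \<sigma> (q i) (q j) (q k))" for u v w
    using trilinear_sum3[OF t, of "\<lambda>i. pairing (proj \<epsilon> (p i)) u" q I
        "\<lambda>i. pairing (proj \<epsilon> (p i)) v" q "\<lambda>i. pairing (proj \<epsilon> (p i)) w" q]
    by (simp only: proj_frame[symmetric])
  define \<tau> where "\<tau> = (\<lambda>f g h. \<sigma> (sharp (dual_apply f)) (sharp (dual_apply g)) (sharp (dual_apply h)))"
  have val: "dual_apply f x = pairing x (sharp (dual_apply f))" for f and x :: "'a gen"
    by (simp add: pairing_commute[of x] pairing_sharp_left linear_dual_apply)
  have "\<tau> = (\<Sum>i\<in>I. \<Sum>j\<in>I. \<Sum>k\<in>I. \<sigma> (q i) (q j) (q k) *\<^sub>R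
      tensor3 (proj \<epsilon> (p i)) (proj \<epsilon> (p j)) (proj \<epsilon> (p k)))" (is "_ = ?R")
  proof (intro ext)
    fix f g h
    have app: "(\<Sum>i\<in>I. F i) x = (\<Sum>i\<in>I. F i x)" for F :: "'a + 'a \<Rightarrow> 'b \<Rightarrow> 'c::real_vector" and x
      using I(1) by (induction I rule: finite_induct) simp_all
    \<comment> \<open>The support of \<sigma> allows the projections to be inserted, and
      \<open>frame\<close> then applies.\<close>
    have "\<tau> f g h = \<sigma> (proj \<epsilon> (sharp (dual_apply f))) (proj \<epsilon> (sharp (dual_apply g)))
        (proj \<epsilon> (sharp (dual_apply h)))"
      unfolding \<tau>_def by (rule trilinear_vanish_proj[OF t z \<epsilon>, symmetric])
    also have "\<dots> = ?R f g h"
      unfolding frame by (simp add: app scaleR_fun_apply tensor3_def val mult.commute)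
    finally show "\<tau> f g h = ?R f g h" .
  qed
  also have "?R \<in> tensor_cube (eigen G \<epsilon>)"
    unfolding tensor_cube_def using proj_in_eigen[OF \<epsilon>]
    by (intro span_sum span_scale span_base) blast
  finally have "\<tau> \<in> sym2_tensor (eigen G \<epsilon>)"
    unfolding sym2_tensor_def \<tau>_def using s by blast
  moreover have "sharp (dual_apply (flat u)) = u" for u :: "'a gen"
    by (rule pairing_eqI) (simp add: pairing_sharp_left linear_dual_apply flat_apply)
  then have "lower \<tau> = \<sigma>"
    by (simp add: lower_def \<tau>_def)
  ultimately show thesis by (rule that)
qed

text \<open>Pairing turns the left side into symmetry of \<open>lower \<tau>\<close> in its last two
  slots, which \<open>flat_sharp\<close> carries over to \<tau>. With the symmetry in the first two
  slots this is full symmetry.\<close>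

lemma alt_lower_eq_0_iff:
  assumes "\<tau> \<in> sym2_tensor (eigen G \<epsilon>)"
  shows "alt (lower \<tau>) = 0 \<longleftrightarrow> \<tau> \<in> sym3 (eigen G \<epsilon>)"
proof -
  have \<tau>: "\<tau> \<in> tensor_cube (eigen G \<epsilon>)" "\<And>f g h. \<tau> f g h = \<tau> g f h"
    using assms by (auto simp: sym2_tensor_def)
  note alt = pairing_alt[OF trilinear_lower[OF \<tau>(1)]]
  show ?thesis
  proof
    assume "alt (lower \<tau>) = 0"
    then have "lower \<tau> u v w = lower \<tau> u w v" for u v w
      using alt[of u v w] by (simp add: pairing_simps)
    then have "\<tau> f g h = \<tau> f h g" for f g h
      unfolding lower_def by (metis flat_sharp)
    then show "\<tau> \<in> sym3 (eigen G \<epsilon>)"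
      using \<tau> unfolding sym3_def by blast
  next
    assume "\<tau> \<in> sym3 (eigen G \<epsilon>)"
    then have "lower \<tau> u v w = lower \<tau> u w v" for u v w
      unfolding sym3_def lower_def by blast
    then show "alt (lower \<tau>) = 0"
      by (intro ext pairing_eqI) (simp add: alt pairing_simps)
  qed
qed

lemma quotient_iso_alt_lower:
  assumes \<epsilon>: "\<epsilon> \<in> {1, -1}"
  shows "\<exists>\<phi>. quotient_iso \<phi> (sym2_tensor (eigen G \<epsilon>)) (sym3 (eigen G \<epsilon>)) (prolongation G \<epsilon>) \<and>
    (\<forall>\<tau>\<in>sym2_tensor (eigen G \<epsilon>). \<phi> (coset (sym3 (eigen G \<epsilon>)) \<tau>) = alt (lower \<tau>))"
proof (rule quotient_iso_from_linear)
  have tri: "trilinear (lower \<tau>)" if "\<tau> \<in> sym2_tensor (eigen G \<epsilon>)" for \<tau>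
    using that by (intro trilinear_lower) (auto simp: sym2_tensor_def)
  note sub = subspace_sym2_tensor[of "eigen G \<epsilon>"]
  show "sym3 (eigen G \<epsilon>) \<subseteq> sym2_tensor (eigen G \<epsilon>)"
    unfolding sym3_def sym2_tensor_def by blast
  show "(\<lambda>\<tau>. alt (lower \<tau>)) ` sym2_tensor (eigen G \<epsilon>) = prolongation G \<epsilon>"
    using lower_eigen_sym2_forms[OF \<epsilon>] lower_surj[OF \<epsilon>]
    unfolding prolongation_eq_alt[OF \<epsilon>] by (auto simp: image_iff) metis
  show "alt (lower (\<tau> + \<tau>')) = alt (lower \<tau>) + alt (lower \<tau>')"
    if "\<tau> \<in> sym2_tensor (eigen G \<epsilon>)" "\<tau>' \<in> sym2_tensor (eigen G \<epsilon>)" for \<tau> \<tau>'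
    using that tri subspace_add[OF sub]
    by (intro ext pairing_eqI) (simp add: pairing_alt pairing_simps, simp add: lower_def)
  show "alt (lower (c *\<^sub>R \<tau>)) = c *\<^sub>R alt (lower \<tau>)"
    if "\<tau> \<in> sym2_tensor (eigen G \<epsilon>)" for c \<tau>
    using that tri subspace_scale[OF sub]
    by (intro ext pairing_eqI)
       (simp add: pairing_alt pairing_simps scaleR_fun_apply,
        simp add: lower_def scaleR_fun_apply right_diff_distrib)
qed (simp_all add: subspace_sym2_tensor subspace_sym3 subspace_prolongation alt_lower_eq_0_iff)

end

section \<open>Levi-Civita generalized connections\<close>

context gen_lie_group
begin

section \<open>Torsion as a three-form\<close>

definition dorfman_form :: "'a gen \<Rightarrow> 'a gen \<Rightarrow> 'a gen \<Rightarrow> real" where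
  "dorfman_form u v w = pairing (dorfman br H u v) w"

lemma dorfman_form_eq:
  "dorfman_form u v w =
    (dual_apply (snd w) (br (fst u) (fst v)) - dual_apply (snd v) (br (fst u) (fst w))
      + dual_apply (snd u) (br (fst v) (fst w)) + H (fst u) (fst v) (fst w)) / 2"
proof -
  \<comment> \<open>The covector part of the bracket is a \<open>Dual\<close>, which can be
    evaluated once its functional is known to be linear.\<close>
  have "linear (\<lambda>Z. - dual_apply \<eta> (br X Z) + dual_apply \<xi> (br Y Z) + H X Y Z)" for X Y \<xi> \<eta>
    using lie H by (simp add: linear_iff lie_algebra_def bilinear_iff three_forms_def trilinear_iff
        dual_apply_add dual_apply_scaleR algebra_simps)
  then show ?thesis
    by (simp add: dorfman_form_def dorfman_def pairing_def dual_apply_Dual)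
qed

text \<open>Left-invariant sections have constant scalar products, so the Dorfman bracket is skew
  here. At equal arguments each term vanishes or cancels another, once through the skewness of
  \<open>br\<close>.\<close>

lemma dorfman_three_form: "dorfman_form \<in> three_forms"
proof -
  have br: "br X X = 0" "bilinear br" for X
    using lie by (auto simp: lie_algebra_def)
  have "br X Y = - br Y X" for X Y
    using br(2) br(1)[of "X + Y"] br(1)[of X] br(1)[of Y] by (simp add: bilinear_iff eq_neg_iff_add_eq_0 add.commute)
  then have skew: "dual_apply \<xi> (br X Y) = - dual_apply \<xi> (br Y X)" for \<xi> X Y
    by (metis linear_neg[OF linear_dual_apply])
  have H': "trilinear H" "H X X Y = 0" "H X Y X = 0" "H Y X X = 0" for X Y
    using H by (auto simp: three_forms_def)
  have "trilinear dorfman_form"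
    using br(2) H'(1) by (simp add: trilinear_iff dorfman_form_eq bilinear_iff dual_apply_add
        dual_apply_scaleR plus_dual_space.rep_eq scaleR_dual_space.rep_eq field_simps)
  moreover have "dorfman_form u u v = 0" "dorfman_form u v u = 0" "dorfman_form v u u = 0" for u v
    using H'(2-4) br(1) skew[of _ "fst u" "fst v"]
    by (simp_all add: dorfman_form_eq linear_0[OF linear_dual_apply])
  ultimately show ?thesis by (simp add: three_forms_def)
qed

text \<open>Skewness turns \<open>- pairing (D v u) w\<close> into \<open>pairing (D v w) u\<close>,
  and the adjoint term becomes \<open>pairing (D w u) v\<close>; with
  \<open>pairing (D u v) w\<close> these are the cyclic terms.\<close>

lemma pairing_torsion:
  assumes "D \<in> generalized_connections"
  shows "pairing (torsion br H D u v) w = bianchi D u v w - dorfman_form u v w"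
proof -
  have "linear (\<lambda>w. D w u)"
    using generalized_connections_bilinear[OF assms] by (simp add: bilinear_def)
  then show ?thesis
    using generalized_connections_skew[OF assms, of v u w]
    by (simp add: torsion_def bianchi_def dorfman_form_def pairing_simps pairing_adj
        pairing_commute[of v])
qed

lemma levi_civita_iff:
  "D \<in> levi_civita br H G \<longleftrightarrow>
    D \<in> generalized_connections \<and> bianchi D = dorfman_form \<and>
    (\<forall>\<epsilon>\<in>{1, -1}. \<forall>u. \<forall>v\<in>eigen G \<epsilon>. D u v \<in> eigen G \<epsilon>)"
proof -
  have "(\<forall>u v. torsion br H D u v = 0) \<longleftrightarrow> bianchi D = dorfman_form"
    if "D \<in> generalized_connections"
  proof
    assume "\<forall>u v. torsion br H D u v = 0"
    then show "bianchi D = dorfman_form"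
      using pairing_torsion[OF that] by (intro ext) (simp add: pairing_simps)
  next
    assume "bianchi D = dorfman_form"
    then show "\<forall>u v. torsion br H D u v = 0"
      by (intro allI pairing_eqI) (simp add: pairing_torsion[OF that] pairing_simps)
  qed
  then show ?thesis unfolding levi_civita_def by blast
qed

text \<open>
  A three-form is the Bianchi sum of a metric connection: cyclic summation counts each
  component of pure type three times, and each component of mixed type once.
\<close>

lemma levi_civita_nonempty: "levi_civita br H G \<noteq> {}"
proof -
  let ?B = dorfman_form and ?p = "proj 1" and ?m = "proj (- 1)"
  have B: "trilinear ?B"
    using dorfman_three_form by (simp add: three_forms_def)
  note skew = three_forms_skew[OF dorfman_three_form]
  have cyc: "?B u v w = ?B v w u" for u v w
    using skew(1)[of u v w] skew(2)[of v u w] by simp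
  \<comment> \<open>A metric connection allows only components whose last two slots have the same
    type. The pure ones are divided by 3; each mixed one carries its odd argument in the first
    slot.\<close>
  define t where "t u v w = ?B (?p u) (?p v) (?p w) / 3 + ?B (?m u) (?m v) (?m w) / 3
    + ?B (?m u) (?p v) (?p w) + ?B (?p u) (?m v) (?m w)" for u v w
  have t: "trilinear t"
    using B linear_proj[of 1] linear_proj[of "- 1"]
    unfolding trilinear_iff t_def by (simp add: linear_add linear_scale field_simps)
  note val = pairing_sharp_trilinear[OF t]
  have "t u v w = - t u w v" for u v w
    unfolding t_def using skew(2)[of _ "?p v" "?p w"] skew(2)[of _ "?m v" "?m w"] by simp
  then have gc: "(\<lambda>u v. sharp (t u v)) \<in> generalized_connections"
    by (rule sharp_generalized_connection[OF t])
  moreover have "bianchi (\<lambda>u v. sharp (t u v)) u v w = ?B u v w" for u v w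
  proof -
    have "?B u v w = ?B (?p u + ?m u) (?p v + ?m v) (?p w + ?m w)"
      by (simp only: proj_sum)
    also have "\<dots> = ?B (?p u) (?p v) (?p w) + ?B (?m u) (?m v) (?m w)
      + ?B (?m u) (?p v) (?p w) + ?B (?p u) (?m v) (?m w)
      + ?B (?p u) (?m v) (?p w) + ?B (?m u) (?p v) (?m w)
      + ?B (?p u) (?p v) (?m w) + ?B (?m u) (?m v) (?p w)"
      using B unfolding trilinear_iff by simp
    also have "\<dots> = t u v w + t v w u + t w u v"
      unfolding t_def
      \<comment> \<open>Cyclic rotation brings the odd argument of each mixed term to the front,
        where exactly one of the three values of \<open>t\<close> supplies it.\<close>
      using cyc[of "?p u" "?p v" "?p w"] cyc[of "?p v" "?p w" "?p u"]
        cyc[of "?m u" "?m v" "?m w"] cyc[of "?m v" "?m w" "?m u"]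
        cyc[of "?p u" "?m v" "?p w"] cyc[of "?m u" "?p v" "?m w"]
        cyc[of "?m w" "?p u" "?p v"] cyc[of "?p w" "?m u" "?m v"] by simp
    finally show ?thesis by (simp add: bianchi_def val)
  qed
  then have "bianchi (\<lambda>u v. sharp (t u v)) = ?B" by (intro ext)
  moreover have "sharp (t u v) \<in> eigen G \<epsilon>" if \<epsilon>: "\<epsilon> \<in> {1, -1}" and v: "v \<in> eigen G \<epsilon>" for \<epsilon> u v
  proof (rule eigen_memI[OF \<epsilon>])
    \<comment> \<open>For \<open>v\<close> and \<open>w\<close> in opposite eigenspaces, every
      summand of \<open>t\<close> has a zero projection in its second or third slot.\<close>
    have B0: "?B x 0 z = 0" "?B x y 0 = 0" for x y z
      using B unfolding trilinear_def by (auto intro: linear_0)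
    fix w assume w: "w \<in> eigen G (- \<epsilon>)"
    show "pairing (sharp (t u v)) w = 0"
      using \<epsilon> v w proj_eigen_opposite[of 1 v] proj_eigen_opposite[of 1 w]
        proj_eigen_opposite[of "- 1" v] proj_eigen_opposite[of "- 1" w]
      by (auto simp: val t_def B0)
  qed
  ultimately have "(\<lambda>u v. sharp (t u v)) \<in> levi_civita br H G"
    unfolding levi_civita_iff by blast
  then show ?thesis by blast
qed

section \<open>Differences of Levi-Civita connections\<close>

text \<open>The pure component of \<open>D\<close>, extended by zero. The value is not projected,
  since \<open>D\<close> will preserve the eigenspaces.\<close>

definition restrict_eigen :: "real \<Rightarrow> ('a gen \<Rightarrow> 'a gen \<Rightarrow> 'a gen) \<Rightarrow> 'a gen \<Rightarrow> 'a gen \<Rightarrow> 'a gen"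
  where "restrict_eigen \<epsilon> D u v = D (proj \<epsilon> u) (proj \<epsilon> v)"

text \<open>As the values lie in \<open>E\<^sub>\<epsilon>\<close>, the test vector may be projected
  too; skewness and the Bianchi identity are then those of \<open>D\<close> at projected
  arguments.\<close>

lemma restrict_eigen_prolongation:
  assumes \<epsilon>: "\<epsilon> \<in> {1, -1}" and gc: "D \<in> generalized_connections" and b: "bianchi D = 0"
    and pres: "\<And>\<epsilon> u v. \<epsilon> \<in> {1, -1} \<Longrightarrow> v \<in> eigen G \<epsilon> \<Longrightarrow> D u v \<in> eigen G \<epsilon>"
  shows "restrict_eigen \<epsilon> D \<in> prolongation G \<epsilon>"
proof -
  have bil: "bilinear D" by (rule generalized_connections_bilinear[OF gc])
  have E: "D u (proj \<epsilon> v) \<in> eigen G \<epsilon>" for u v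
    by (rule pres[OF \<epsilon> proj_in_eigen[OF \<epsilon>]])
  have val: "pairing (restrict_eigen \<epsilon> D u v) w = pairing (D (proj \<epsilon> u) (proj \<epsilon> v)) (proj \<epsilon> w)" for u v w
    unfolding restrict_eigen_def using proj_eigen[OF \<epsilon> E] by (metis proj_self_adjoint)
  have "restrict_eigen \<epsilon> D \<in> generalized_connections"
  proof (rule generalized_connectionsI)
    show "bilinear (restrict_eigen \<epsilon> D)"
      using bil by (simp add: bilinear_iff restrict_eigen_def linear_add[OF linear_proj]
          linear_scale[OF linear_proj])
    show "pairing (restrict_eigen \<epsilon> D u v) w = - pairing (restrict_eigen \<epsilon> D u w) v" for u v w
      unfolding val by (rule generalized_connections_skew[OF gc])
  qed
  moreover have "D 0 v = 0" "D v 0 = 0" for v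
    using bil unfolding bilinear_def by (auto intro: linear_0)
  moreover have "bianchi (restrict_eigen \<epsilon> D) u v w = bianchi D (proj \<epsilon> u) (proj \<epsilon> v) (proj \<epsilon> w)"
    for u v w
    by (simp add: bianchi_def val)
  then have "bianchi (restrict_eigen \<epsilon> D) = 0"
    by (simp add: b fun_eq_iff)
  ultimately show ?thesis
    using E proj_eigen_opposite[OF \<epsilon>]
    by (simp add: prolongation_def eigen_so_def restrict_eigen_def fun_eq_iff)
qed

text \<open>
  On arguments of mixed type the Bianchi identity of a map preserving \<open>E\<^sub>+\<close> and \<open>E\<^sub>-\<close> has a
  single non-zero term, so that the mixed part of such a map vanishes.
\<close>

lemma restrict_eigen_decomposition:
  assumes gc: "D \<in> generalized_connections" and b: "bianchi D = 0"
    and pres: "\<And>\<epsilon> u v. \<epsilon> \<in> {1, -1} \<Longrightarrow> v \<in> eigen G \<epsilon> \<Longrightarrow> D u v \<in> eigen G \<epsilon>"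
  shows "D = restrict_eigen 1 D + restrict_eigen (- 1) D"
proof (intro ext)
  fix u v
  have bil: "bilinear D" by (rule generalized_connections_bilinear[OF gc])
  have mixed: "D x y = 0" if \<epsilon>: "\<epsilon> \<in> {1, -1}" and x: "x \<in> eigen G (- \<epsilon>)" and y: "y \<in> eigen G \<epsilon>"
    for \<epsilon> x y
  proof (rule pairing_eqI)
    fix w
    have \<epsilon>': "- \<epsilon> \<in> {1, -1}" using \<epsilon> by auto
    \<comment> \<open>\<open>D x y\<close> lies in \<open>E\<^sub>\<epsilon>\<close>, so testing it
      against projected vectors is enough.\<close>
    let ?w = "proj \<epsilon> w"
    have w: "?w \<in> eigen G \<epsilon>" by (rule proj_in_eigen[OF \<epsilon>])
    have "pairing (D y ?w) x = 0" "pairing (D ?w x) y = 0"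
      \<comment> \<open>Both terms pair vectors of opposite eigenspaces: \<open>D y ?w\<close> with
        \<open>x\<close>, and \<open>D ?w x\<close> with \<open>y\<close>.\<close>
      using eigen_orthogonal[OF \<epsilon> pres[OF \<epsilon> w] x] eigen_orthogonal[OF \<epsilon>' pres[OF \<epsilon>' x]] y
      by auto
    moreover have "bianchi D x y ?w = 0" by (simp add: b)
    ultimately have "pairing (D x y) ?w = 0" by (simp add: bianchi_def)
    then show "pairing (D x y) w = pairing 0 w"
      using proj_eigen[OF \<epsilon> pres[OF \<epsilon> y, of x]] proj_self_adjoint[of \<epsilon> "D x y" w]
      by (simp add: pairing_simps)
  qed
  have "D u v = D (proj 1 u + proj (- 1) u) (proj 1 v + proj (- 1) v)"
    by (simp only: proj_sum)
  also have "\<dots> = restrict_eigen 1 D u v + restrict_eigen (- 1) D u v"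
    using bil mixed[of 1 "proj (- 1) u" "proj 1 v"] mixed[of "- 1" "proj 1 u" "proj (- 1) v"]
      proj_in_eigen[of 1] proj_in_eigen[of "- 1"]
    by (simp add: bilinear_iff restrict_eigen_def)
  finally show "D u v = (restrict_eigen 1 D + restrict_eigen (- 1) D) u v" by simp
qed

lemma prolongation_preserves_eigen:
  assumes "\<alpha> \<in> prolongation G \<delta>" "\<delta> \<in> {1, -1}" "\<epsilon> \<in> {1, -1}" "v \<in> eigen G \<epsilon>"
  shows "\<alpha> u v \<in> eigen G \<epsilon>"
proof (cases "\<epsilon> = \<delta>")
  case True
  then show ?thesis using assms by (auto simp: prolongation_def eigen_so_def)
next
  case False
  then have "\<epsilon> = - \<delta>" using assms(2,3) by auto
  then have "\<alpha> u v = 0" using assms by (auto simp: prolongation_def eigen_so_def)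
  then show ?thesis by (simp add: subspace_0[OF subspace_eigen])
qed

text \<open>The translation vector is unique because it must be the difference
  \<open>D' - D\<close>; that the sum of the two prolongations is direct is the content of
  \<open>prolongation_inter\<close>.\<close>

lemma levi_civita_affine:
  "affine_space_modeled_on (levi_civita br H G)
    {\<alpha> + \<beta> | \<alpha> \<beta>. \<alpha> \<in> prolongation G 1 \<and> \<beta> \<in> prolongation G (-1)}"
  unfolding affine_space_modeled_on_def
proof (intro conjI ballI)
  let ?V = "{\<alpha> + \<beta> | \<alpha> \<beta>. \<alpha> \<in> prolongation G 1 \<and> \<beta> \<in> prolongation G (-1)}"
  show "subspace ?V"
    using subspace_sums[OF subspace_prolongation subspace_prolongation] by simp
  show "levi_civita br H G \<noteq> {}" by (rule levi_civita_nonempty)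
  show "D + \<gamma> \<in> levi_civita br H G" if D: "D \<in> levi_civita br H G" and "\<gamma> \<in> ?V" for D \<gamma>
  proof -
    obtain \<alpha> \<beta> where \<gamma>: "\<gamma> = \<alpha> + \<beta>" and \<alpha>: "\<alpha> \<in> prolongation G 1" and \<beta>: "\<beta> \<in> prolongation G (-1)"
      using \<open>\<gamma> \<in> ?V\<close> by blast
    have "D + \<gamma> \<in> generalized_connections"
      using D \<alpha> \<beta> unfolding \<gamma> levi_civita_iff prolongation_def eigen_so_def
      by (intro subspace_add[OF subspace_generalized_connections]) auto
    moreover have "bianchi (D + \<gamma>) = dorfman_form"
      using D \<alpha> \<beta> unfolding \<gamma> levi_civita_iff prolongation_def by (simp add: bianchi_add)
    moreover have "(D + \<gamma>) u v \<in> eigen G \<epsilon>" if \<epsilon>: "\<epsilon> \<in> {1, -1}" "v \<in> eigen G \<epsilon>" for \<epsilon> u v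
    proof -
      have "D u v \<in> eigen G \<epsilon>" using D \<epsilon> unfolding levi_civita_iff by blast
      moreover have "\<alpha> u v \<in> eigen G \<epsilon>" "\<beta> u v \<in> eigen G \<epsilon>"
        using prolongation_preserves_eigen[OF \<alpha> _ \<epsilon>] prolongation_preserves_eigen[OF \<beta> _ \<epsilon>] by auto
      ultimately show ?thesis by (simp add: \<gamma> subspace_add[OF subspace_eigen])
    qed
    ultimately show ?thesis unfolding levi_civita_iff by blast
  qed
  show "\<exists>!\<gamma>. \<gamma> \<in> ?V \<and> D' = D + \<gamma>"
    if "D \<in> levi_civita br H G" "D' \<in> levi_civita br H G" for D D'
  proof -
    let ?d = "D' - D"
    have gc: "?d \<in> generalized_connections"
      using that by (intro subspace_diff[OF subspace_generalized_connections]) (auto simp: levi_civita_iff)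
    have b: "bianchi ?d = 0"
      using that by (simp add: bianchi_diff levi_civita_iff)
    have pres: "?d u v \<in> eigen G \<epsilon>" if "\<epsilon> \<in> {1, -1}" "v \<in> eigen G \<epsilon>" for \<epsilon> u v
    proof -
      have "D u v \<in> eigen G \<epsilon>" "D' u v \<in> eigen G \<epsilon>"
        using \<open>D \<in> _\<close> \<open>D' \<in> _\<close> that unfolding levi_civita_iff by blast+
      then show ?thesis by (simp add: subspace_diff[OF subspace_eigen])
    qed
    have "?d = restrict_eigen 1 ?d + restrict_eigen (- 1) ?d"
      by (rule restrict_eigen_decomposition[OF gc b pres])
    moreover have "restrict_eigen 1 ?d \<in> prolongation G 1"
      "restrict_eigen (- 1) ?d \<in> prolongation G (-1)"
      by (rule restrict_eigen_prolongation[OF _ gc b pres]; simp)+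
    ultimately have "?d \<in> ?V" by blast
    then show ?thesis by (intro ex1I[of _ ?d]) auto
  qed
qed

end

theorem proposition2p8:
  fixes br :: "'a::real_vector \<Rightarrow> 'a \<Rightarrow> 'a"
    and H :: "'a \<Rightarrow> 'a \<Rightarrow> 'a \<Rightarrow> real"
    and G :: "'a gen \<Rightarrow> 'a gen \<Rightarrow> real"
  assumes "generalized_lie_group br H G"
  shows "affine_space_modeled_on (levi_civita br H G)
           {\<alpha> + \<beta> | \<alpha> \<beta>. \<alpha> \<in> prolongation G 1 \<and> \<beta> \<in> prolongation G (-1)} \<and>
         subspace (prolongation G 1) \<and> subspace (prolongation G (-1)) \<and>
         prolongation G 1 \<inter> prolongation G (-1) = {0} \<and>
         (\<forall>\<epsilon>\<in>{1, -1}.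
           bianchi ` eigen_so G \<epsilon> \<subseteq> three_forms \<and>
           alt ` eigen_sym2_forms G \<epsilon> \<subseteq> eigen_so G \<epsilon> \<and>
           prolongation G \<epsilon> = alt ` eigen_sym2_forms G \<epsilon> \<and>
           (\<exists>\<phi>. quotient_iso \<phi> (sym2_tensor (eigen G \<epsilon>)) (sym3 (eigen G \<epsilon>)) (prolongation G \<epsilon>) \<and>
                (\<forall>\<tau>\<in>sym2_tensor (eigen G \<epsilon>). \<phi> (coset (sym3 (eigen G \<epsilon>)) \<tau>) = alt (lower \<tau>))))"
proof -
  interpret gen_lie_group br H G
    using assms by unfold_locales (simp_all add: generalized_lie_group_def)
  have "bianchi ` eigen_so G \<epsilon> \<subseteq> three_forms" for \<epsilon>
    using bianchi_three_form by (auto simp: eigen_so_def)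
  moreover have "alt ` eigen_sym2_forms G \<epsilon> \<subseteq> eigen_so G \<epsilon>" if "\<epsilon> \<in> {1, -1}" for \<epsilon>
    using alt_eigen_so[OF that] by (rule image_subsetI)
  ultimately show ?thesis
    by (intro conjI ballI levi_civita_affine subspace_prolongation prolongation_inter
        prolongation_eq_alt quotient_iso_alt_lower)
qed

end
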